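(* Let $s>0$ and let $X$ be an $s$-regular metric space. Then there is a constant $c>0$ such that $$\overline{\dim}_A(E)\le s-c\varrho^s$$ for all $0\le\varrho\le1$ and all nonempty $\varrho$-porous sets $E\subset X$.
   Context: $X$ contains at least two points; balls $B(x,r)=\{y:d(x,y)\le r\}$ are closed. A measure is a nontrivial Borel regular outer measure for which bounded sets have finite measure. $X$ is $s$-regular if it carries a measure $\mu$ for which there is $C\ge1$ with $C^{-1}r^s\le\mu(B(x,r))\le Cr^s$ for all $x\in X$ and $0<r<\operatorname{diam}(X)$ (such a space is doubling: every ball of radius $r$ can be covered by a fixed number of balls of radius $r/2$). A set $E\subset X$ is $\varrho$-porous ($0\le\varrho\le1$) if for every $x\in E$ and all $0<r<\operatorname{diam}(E)$ there is $y\in X$ with $B(y,\varrho r)\subset B(x,r)\setminus E$. The upper Assouad dimension $\overline{\dim}_A(X)$ of a metric space $X$ is the infimum of all $t\ge0$ for which there is $C\ge1$ such that each ball $B(x,R)$ can be covered by at most $C(r/R)^{-t}$ balls of radius $r$ for all $0<r<R<\operatorname{diam}(X)$. For $E\subset X$, $\overline{\dim}_A(E)$ is defined by considering $E$ as a metric space with the restricted metric. *)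

theory Defs
  imports "HOL-Analysis.Analysis"
begin

(* The ambient metric space X is the carrier UNIV of a type of class metric_space;
   subsets E of X are sets over that type. *)

(* The library's diameter is real-valued and has no meaningful value on unbounded sets; diam(X) may be
   infinite here. *)
definition ediam :: "'a::metric_space set \<Rightarrow> ereal" where
  "ediam S = (SUP (x, y) \<in> S \<times> S. ereal (dist x y))"

(* Outer measures are defined on all subsets. lambda_system UNIV UNIV mu is the family of
   Caratheodory measurable sets. *)
definition borel_regular_outer_measure :: "('a::topological_space set \<Rightarrow> ennreal) \<Rightarrow> bool" where
  "borel_regular_outer_measure \<mu> \<longleftrightarrow>
     outer_measure_space UNIV \<mu> \<and>
     sets borel \<subseteq> lambda_system UNIV UNIV \<mu> \<and>
     (\<forall>A. \<exists>B \<in> sets borel. A \<subseteq> B \<and> \<mu> B = \<mu> A)"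

definition measure_on_space :: "('a::metric_space set \<Rightarrow> ennreal) \<Rightarrow> bool" where
  "measure_on_space \<mu> \<longleftrightarrow>
     borel_regular_outer_measure \<mu> \<and>
     (\<exists>A. \<mu> A \<noteq> 0) \<and>
     (\<forall>A. bounded A \<longrightarrow> \<mu> A < \<infinity>)"

definition s_regular_space :: "'a::metric_space itself \<Rightarrow> real \<Rightarrow> bool" where
  "s_regular_space X s \<longleftrightarrow>
     (\<exists>\<mu> :: 'a set \<Rightarrow> ennreal. measure_on_space \<mu> \<and>
       (\<exists>C\<ge>1. \<forall>(x::'a) r. 0 < r \<and> ereal r < ediam (UNIV :: 'a set) \<longrightarrow>
          ennreal (inverse C * r powr s) \<le> \<mu> (cball x r) \<and>
          \<mu> (cball x r) \<le> ennreal (C * r powr s)))"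

definition porous :: "real \<Rightarrow> 'a::metric_space set \<Rightarrow> bool" where
  "porous \<rho> E \<longleftrightarrow>
     (\<forall>x\<in>E. \<forall>r. 0 < r \<and> ereal r < ediam E \<longrightarrow>
        (\<exists>y. cball y (\<rho> * r) \<subseteq> cball x r - E))"

(* S is regarded as a metric space with the restricted metric: its balls are the sets
   cball x r \<inter> S with x in S, so the covering balls are centred in S. F is the finite set of
   centres. *)
definition assouad_exponent :: "'a::metric_space set \<Rightarrow> real \<Rightarrow> bool" where
  "assouad_exponent S t \<longleftrightarrow>
     (\<exists>C\<ge>1. \<forall>x\<in>S. \<forall>r R. 0 < r \<and> r < R \<and> ereal R < ediam S \<longrightarrow>
        (\<exists>F. finite F \<and> F \<subseteq> S \<and> real (card F) \<le> C * (r / R) powr (- t) \<and>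
             cball x R \<inter> S \<subseteq> (\<Union>y\<in>F. cball y r \<inter> S)))"

(* The value is \<infinity> if there is no admissible exponent. *)
definition upper_assouad_dim :: "'a::metric_space set \<Rightarrow> ereal" where
  "upper_assouad_dim S = Inf (ereal ` {t. 0 \<le> t \<and> assouad_exponent S t})"

end

theory Submission
  imports Defs
begin

text \<open>Regularity enters only through a packing inequality: disjoint balls of radii \<open>r\<^sub>j\<close> inside a ball
of radius \<open>R\<close> satisfy \<open>\<Sum> r\<^sub>j\<^sup>s \<le> K R\<^sup>s\<close>. Fix \<open>x \<in> E\<close> and attach a hole of radius \<open>\<rho> R / 2\<^sup>k\<close> to
each point of a maximal separated subset of \<open>E \<inter> B(x,R)\<close> at each of the scales \<open>R / 2\<^sup>k\<close>, \<open>k < m\<close>.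
Holes of different scales may overlap, but a Vitali selection charges every hole to a larger
selected one, and each selected hole is charged by boundedly many holes per scale, so the total mass
of all holes is still \<open>O(R\<^sup>s)\<close>. If \<open>E \<inter> B(x,R)\<close> contains \<open>n\<close> points that are \<open>R / 2\<^sup>m\<close>-separated, each
scale contributes at least a multiple of \<open>n 2\<^bsup>-ms\<^esup> \<rho>\<^sup>s R\<^sup>s\<close>, whence \<open>n \<le> K' 2\<^bsup>ms\<^esup> / (m \<rho>\<^sup>s)\<close>. Choosing
\<open>m\<close> comparable to \<open>\<rho>\<^bsup>-s\<^esup>\<close> makes this at most \<open>2\<^bsup>ms\<^esup> / 2\<close>, and iterating gives the exponent \<open>s - 1/m\<close>.
Counting all \<open>m\<close> scales together avoids the logarithmic loss of a scale-by-scale argument.\<close>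

section \<open>Diameters, disjoint families and elementary sums\<close>

lemma ediam_mono: "S \<subseteq> T \<Longrightarrow> ediam S \<le> ediam T"
  unfolding ediam_def by (rule SUP_subset_mono) auto

lemma dist_le_of_ediam_le:
  assumes "ediam S \<le> ereal R" "p \<in> S" "q \<in> S"
  shows "dist p q \<le> R"
proof -
  have "ereal (dist p q) \<le> ediam S"
    unfolding ediam_def using assms(2,3)
    by (intro SUP_upper2[where i = "(p, q)"]) auto
  also note assms(1)
  finally show ?thesis by simp
qed

lemma upper_assouad_dim_le: "0 \<le> t \<Longrightarrow> assouad_exponent E t \<Longrightarrow> upper_assouad_dim E \<le> ereal t"
  unfolding upper_assouad_dim_def by (intro Inf_lower) auto

text \<open>Caratheodory's condition for \<open>B i\<close>, tested on the arbitrary set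
  \<open>A\<close>, splits off \<open>\<mu> (B i)\<close>. By disjointness the remaining sets lie in
  \<open>A - B i\<close>, to which the induction hypothesis applies.\<close>

lemma sum_lambda_system_le:
  fixes \<mu> :: "'a set \<Rightarrow> ennreal"
  assumes "finite J" "\<And>j. j \<in> J \<Longrightarrow> B j \<in> lambda_system UNIV UNIV \<mu>"
    and "disjoint_family_on B J" "\<And>j. j \<in> J \<Longrightarrow> B j \<subseteq> A"
  shows "(\<Sum>j\<in>J. \<mu> (B j)) \<le> \<mu> A"
  using assms
proof (induction J arbitrary: A rule: finite_induct)
  case empty
  then show ?case by simp
next
  case (insert i J)
  have "B j \<subseteq> A - B i" if "j \<in> J" for j
  proof -
    have "B j \<inter> B i = {}"
      using insert.prems(2) insert.hyps(2) that by (auto simp: disjoint_family_on_def)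
    then show ?thesis using insert.prems(3)[of j] that by blast
  qed
  then have "(\<Sum>j\<in>J. \<mu> (B j)) \<le> \<mu> (A - B i)"
    using insert.prems
    by (intro insert.IH) (auto simp: disjoint_family_on_def)
  moreover have "\<mu> (B i \<inter> A) + \<mu> ((UNIV - B i) \<inter> A) = \<mu> A"
    using insert.prems(1)[of i] by (simp add: lambda_system_def)
  moreover have "B i \<inter> A = B i" "(UNIV - B i) \<inter> A = A - B i"
    using insert.prems(3)[of i] by auto
  ultimately show ?case
    using insert.hyps by (metis add_left_mono sum.insert)
qed

text \<open>Greedy choice: take an index \<open>i0\<close> of largest \<open>r\<close>, charge to it
  every set meeting \<open>B i0\<close>, and recurse on the rest. As \<open>B i0\<close> is nonempty
  it meets itself, so the rest is strictly smaller.\<close>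

lemma finite_Vitali_selection:
  fixes r :: "'i \<Rightarrow> real"
  assumes "finite I" "\<And>i. i \<in> I \<Longrightarrow> B i \<noteq> {}"
  shows "\<exists>J\<subseteq>I. disjoint_family_on B J \<and> (\<forall>i\<in>I. \<exists>j\<in>J. r i \<le> r j \<and> B i \<inter> B j \<noteq> {})"
  using assms
proof (induction "card I" arbitrary: I rule: less_induct)
  case less
  show ?case
  proof (cases "I = {}")
    case True
    then show ?thesis by (auto simp: disjoint_family_on_def)
  next
    case False
    then have "Max (r ` I) \<in> r ` I" using less.prems by (intro Max_in) auto
    then obtain i0 where i0: "i0 \<in> I" "r i0 = Max (r ` I)" by auto
    have max: "r i \<le> r i0" if "i \<in> I" for i
      using that less.prems i0 by simp
    define I' where "I' = {i \<in> I. B i \<inter> B i0 = {}}"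
    have "I' \<subset> I" using i0 less.prems by (auto simp: I'_def)
    then have "card I' < card I" using less.prems(1) by (rule psubset_card_mono[rotated])
    then obtain J where J: "J \<subseteq> I'" "disjoint_family_on B J"
        "\<forall>i\<in>I'. \<exists>j\<in>J. r i \<le> r j \<and> B i \<inter> B j \<noteq> {}"
      using less.hyps[of I'] less.prems by (auto simp: I'_def)
    have "disjoint_family_on B (insert i0 J)"
      using J(1,2) unfolding disjoint_family_on_def I'_def by blast
    moreover have "\<exists>j\<in>insert i0 J. r i \<le> r j \<and> B i \<inter> B j \<noteq> {}" if "i \<in> I" for i
      using J(3) that max by (cases "i \<in> I'") (auto simp: I'_def)
    moreover have "insert i0 J \<subseteq> I" using J(1) i0 by (auto simp: I'_def)
    ultimately show ?thesis by blast
  qed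
qed

lemma card_le_cover_mult:
  fixes b :: real
  assumes "finite F" "finite G" "F \<subseteq> (\<Union>g\<in>G. cball g t)"
    and "\<And>g. g \<in> G \<Longrightarrow> card (F \<inter> cball g t) \<le> b"
  shows "card F \<le> card G * b"
proof -
  have "card F \<le> card (\<Union>g\<in>G. F \<inter> cball g t)"
    using assms(1-3) by (intro card_mono) auto
  also have "\<dots> \<le> (\<Sum>g\<in>G. card (F \<inter> cball g t))"
    using assms by (intro card_UN_le) auto
  finally have "real (card F) \<le> (\<Sum>g\<in>G. real (card (F \<inter> cball g t)))"
    by (metis of_nat_le_iff of_nat_sum)
  also have "\<dots> \<le> (\<Sum>g\<in>G. b)" using assms by (intro sum_mono) auto
  finally show ?thesis by simp
qed

lemma sum_geometric_tail_le:
  fixes q :: real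
  assumes "0 \<le> q" "q < 1"
  shows "(\<Sum>k\<in>{l..<m}. q ^ k) \<le> q ^ l / (1 - q)"
proof (cases "l \<le> m")
  case True
  then have "(1 - q) * (\<Sum>k\<in>{l..<m}. q ^ k) = q ^ l - q ^ m"
  proof (induction m rule: dec_induct)
    case (step n)
    have "(1 - q) * (\<Sum>k\<in>{l..<Suc n}. q ^ k) = (1 - q) * (\<Sum>k\<in>{l..<n}. q ^ k) + (1 - q) * q ^ n"
      using step.hyps by (simp add: distrib_left)
    then show ?case unfolding step.IH by (simp add: left_diff_distrib)
  qed simp
  then have "(1 - q) * (\<Sum>k\<in>{l..<m}. q ^ k) \<le> q ^ l" using assms by simp
  then show ?thesis using assms by (simp add: field_simps)
qed (use assms in auto)

lemma power_powr:
  fixes a s :: real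
  assumes "0 < a"
  shows "(a ^ k) powr s = (a powr s) ^ k"
  using assms by (simp add: powr_realpow[symmetric] powr_powr mult.commute)

lemma powr_div_power:
  fixes a s :: real
  assumes "0 \<le> a"
  shows "(a / 2 ^ k) powr s = a powr s * (2 powr - s) ^ k"
proof -
  have "(a / 2 ^ k) powr s = a powr s / (2 powr s) ^ k"
    using assms by (simp add: powr_divide power_powr)
  also have "\<dots> = a powr s * (2 powr - s) ^ k"
    by (simp only: powr_minus power_inverse divide_inverse)
  finally show ?thesis .
qed

section \<open>Packing and separated nets in a regular space\<close>

text \<open>The bound \<open>upper\<close> has no restriction by the diameter, since it is applied
  to enclosing balls such as \<open>cball x (2 * R)\<close>, whose radius may exceed the diameter of
  the space.\<close>

locale packing_space =
  fixes \<mu> :: "'a::metric_space set \<Rightarrow> ennreal" and s C :: real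
  assumes s_pos: "0 < s" and C_ge: "1 \<le> C"
    and borel_measurable: "sets borel \<subseteq> lambda_system UNIV UNIV \<mu>"
    and lower: "\<And>x r. 0 < r \<Longrightarrow> ereal r < ediam (UNIV :: 'a set) \<Longrightarrow>
      ennreal (inverse C * r powr s) \<le> \<mu> (cball x r)"
    and upper: "\<And>x r. 0 < r \<Longrightarrow> \<mu> (cball x r) \<le> ennreal (C * r powr s)"
begin

definition K where "K = C * C"

lemma K_ge: "1 \<le> K"
  using C_ge mult_mono[of 1 C 1 C] by (simp add: K_def)

text \<open>Disjoint balls have total mass at most that of the enclosing ball. The lower bound on
  the small balls and the upper bound on the large one each cost a factor \<open>C\<close>, hence
  \<open>K = C * C\<close>.\<close>

lemma packing:
  fixes y :: "'i \<Rightarrow> 'a" and x :: 'a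
  assumes "finite J" "disjoint_family_on (\<lambda>j. cball (y j) (r j)) J"
    and "\<And>j. j \<in> J \<Longrightarrow> 0 < r j" "\<And>j. j \<in> J \<Longrightarrow> ereal (r j) < ediam (UNIV :: 'a set)"
    and "\<And>j. j \<in> J \<Longrightarrow> cball (y j) (r j) \<subseteq> cball x R" "0 < R"
  shows "(\<Sum>j\<in>J. r j powr s) \<le> K * R powr s"
proof -
  have "ennreal (\<Sum>j\<in>J. inverse C * r j powr s) = (\<Sum>j\<in>J. ennreal (inverse C * r j powr s))"
    using C_ge by (intro sum_ennreal[symmetric]) auto
  also have "\<dots> \<le> (\<Sum>j\<in>J. \<mu> (cball (y j) (r j)))"
    using assms by (intro sum_mono lower) auto
  also have "\<dots> \<le> \<mu> (cball x R)"
    using assms borel_measurable by (intro sum_lambda_system_le) auto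
  also have "\<dots> \<le> ennreal (C * R powr s)" using assms by (intro upper)
  finally have "(\<Sum>j\<in>J. inverse C * r j powr s) \<le> C * R powr s"
    using C_ge by (simp add: ennreal_le_iff)
  then have "C * (inverse C * (\<Sum>j\<in>J. r j powr s)) \<le> C * (C * R powr s)"
    using C_ge by (intro mult_left_mono) (simp_all add: sum_distrib_left)
  then show ?thesis using C_ge by (simp add: K_def mult.assoc[symmetric])
qed

text \<open>Balls of radius \<open>r / 2\<close> about the points are disjoint and lie in
  \<open>cball x (R + r / 2)\<close>; the factors \<open>2 powr s\<close> cancel.\<close>

lemma separated_card_le:
  fixes F :: "'a set"
  assumes "finite F" "pairwise (\<lambda>p q. r < dist p q) F" "F \<subseteq> cball x R"
    and "0 < r" "0 \<le> R" "ereal (r / 2) < ediam (UNIV :: 'a set)"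
  shows "card F * r powr s \<le> K * (2 * R + r) powr s"
proof -
  have "(\<Sum>p\<in>F. (r / 2) powr s) \<le> K * (R + r / 2) powr s"
  proof (rule packing[where y = "\<lambda>p. p" and x = x])
    show "disjoint_family_on (\<lambda>p. cball p (r / 2)) F"
      unfolding disjoint_family_on_def
    proof (intro ballI impI)
      fix p q assume "p \<in> F" "q \<in> F" "p \<noteq> q"
      then have "r < dist p q" using assms(2) by (auto simp: pairwise_def)
      then have "False" if "dist p z \<le> r / 2" "dist q z \<le> r / 2" for z
        using that dist_triangle2[of p q z] by simp
      then show "cball p (r / 2) \<inter> cball q (r / 2) = {}" by auto
    qed
    show "cball p (r / 2) \<subseteq> cball x (R + r / 2)" if "p \<in> F" for p
    proof
      fix z assume "z \<in> cball p (r / 2)"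
      then show "z \<in> cball x (R + r / 2)"
        using assms(3) that dist_triangle[of x z p] by fastforce
    qed
  qed (use assms in auto)
  then have *: "card F * (r / 2) powr s \<le> K * ((2 * R + r) / 2) powr s"
    by (simp add: field_simps)
  have "card F * r powr s / 2 powr s \<le> K * (2 * R + r) powr s / 2 powr s"
    using * assms by (simp add: powr_divide)
  then show ?thesis by (simp add: divide_le_cancel)
qed

lemma separated_card_le_scaled:
  fixes F :: "'a set"
  assumes "finite F" "pairwise (\<lambda>p q. r < dist p q) F" "F \<subseteq> cball x R"
    and "0 < r" "0 \<le> R" "ereal (r / 2) < ediam (UNIV :: 'a set)" "2 * R + r \<le> a * r"
  shows "card F \<le> K * a powr s"
proof -
  have "0 < a * r" using assms by linarith
  then have "0 < a" using assms(4) by (simp add: zero_less_mult_iff)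
  have "card F * r powr s \<le> K * (2 * R + r) powr s"
    using assms by (intro separated_card_le)
  also have "\<dots> \<le> K * (a * r) powr s"
    using assms s_pos K_ge by (intro mult_left_mono powr_mono2) auto
  also have "\<dots> = K * a powr s * r powr s"
    using assms \<open>0 < a\<close> by (simp add: powr_mult)
  finally show ?thesis using assms(4) by simp
qed

text \<open>The packing bound limits the cardinality of separated subsets, so one of largest
  cardinality exists. A point of \<open>A\<close> left uncovered could be added to it.\<close>

lemma maximal_separated:
  fixes A :: "'a set"
  assumes "A \<subseteq> cball x R" "0 < r" "0 \<le> R" "ereal (r / 2) < ediam (UNIV :: 'a set)"
  shows "\<exists>F. finite F \<and> F \<subseteq> A \<and> pairwise (\<lambda>p q. r < dist p q) F \<and> A \<subseteq> (\<Union>y\<in>F. cball y r)"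
proof -
  define P where "P F \<longleftrightarrow> finite F \<and> F \<subseteq> A \<and> pairwise (\<lambda>p q. r < dist p q) F" for F
  have bound: "card F < Suc (nat \<lceil>K * ((2 * R + r) / r) powr s\<rceil>)" if "P F" for F
  proof -
    have "card F \<le> K * ((2 * R + r) / r) powr s"
      using that assms by (intro separated_card_le_scaled[of F r x R]) (auto simp: P_def)
    then show ?thesis by linarith
  qed
  have "P {}" by (simp add: P_def)
  then obtain F where F: "P F" "\<And>F'. P F' \<Longrightarrow> card F' \<le> card F"
    using ex_has_greatest_nat[of P "{}" card] bound by metis
  have "p \<in> (\<Union>y\<in>F. cball y r)" if "p \<in> A" for p
  proof (rule ccontr)
    assume *: "p \<notin> (\<Union>y\<in>F. cball y r)"
    then have "p \<notin> F" using assms(2) by force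
    moreover have "P (insert p F)"
      using F(1) that * by (force simp: P_def pairwise_insert dist_commute)
    then have "card (insert p F) \<le> card F" by (rule F(2))
    ultimately show False using F(1) by (simp add: P_def)
  qed
  then have "A \<subseteq> (\<Union>y\<in>F. cball y r)" by blast
  then show ?thesis using F(1) unfolding P_def by blast
qed

section \<open>Total mass of the holes at all scales\<close>

text \<open>The factors with 5, 4 and 2 come from comparing a fine separated set with a coarse net,
  from counting the holes charged to a selected one at one scale, and from packing the selected
  holes. The last \<open>2 powr s\<close> makes up for halved hole radii, and the denominator sums a
  geometric series over the scales.\<close>

definition K' where
  "K' = K * 5 powr s * (K * 4 powr s * (K * 2 powr s)) * 2 powr s / (1 - 2 powr - s)"

text \<open>The bound depends neither on the number \<open>m\<close> of scales nor on
  \<open>\<rho>\<close>. Balls of half the hole radius are used, so that each centre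
  \<open>y j\<close> stays farther than \<open>2 * t j\<close> from \<open>E\<close>; this confines
  the holes charged to a selected one.\<close>

lemma hole_total_mass:
  fixes \<rho> R :: real and G :: "nat \<Rightarrow> 'a set" and y :: "nat \<times> 'a \<Rightarrow> 'a"
  defines "t \<equiv> \<lambda>i. \<rho> * (R / 2 ^ fst i) / 2"
  assumes \<rho>: "0 < \<rho>" "\<rho> \<le> 1" and R: "0 < R" "ereal R < ediam (UNIV :: 'a set)"
    and finG: "\<And>k. k < m \<Longrightarrow> finite (G k)"
    and G: "\<And>k. k < m \<Longrightarrow> G k \<subseteq> E \<inter> cball x R"
    and sepG: "\<And>k. k < m \<Longrightarrow> pairwise (\<lambda>p q. 2 * (R / 2 ^ k) < dist p q) (G k)"
    and y: "\<And>k g. k < m \<Longrightarrow> g \<in> G k \<Longrightarrow>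
      cball (y (k, g)) (\<rho> * (R / 2 ^ k)) \<subseteq> cball g (R / 2 ^ k) - E"
  shows "(\<Sum>i\<in>Sigma {..<m} G. t i powr s) \<le> K * 4 powr s / (1 - 2 powr - s) * (K * (2 * R) powr s)"
proof -
  let ?I = "Sigma {..<m} G"
  let ?q = "2 powr - s"
  have finI: "finite ?I" using finG by auto
  have tpos: "0 < t i" for i using \<rho> R by (simp add: t_def)
  have le: "R / 2 ^ k \<le> R" for k
    using R by (simp add: field_simps)
  have less_ediam: "ereal a < ediam (UNIV :: 'a set)" if "a \<le> R" for a
    using that R(2) by (metis ereal_less_eq(3) le_less_trans)
  have q: "0 \<le> ?q" "?q < 1"
    using s_pos by (auto simp: powr_minus powr_less_one field_simps)
  have "cball (y i) (t i) \<noteq> {}" for i using tpos[of i] by simp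
  then obtain J where J: "J \<subseteq> ?I" "disjoint_family_on (\<lambda>i. cball (y i) (t i)) J"
      and "\<forall>i\<in>?I. \<exists>j\<in>J. t i \<le> t j \<and> cball (y i) (t i) \<inter> cball (y j) (t j) \<noteq> {}"
    using finite_Vitali_selection[OF finI, of "\<lambda>i. cball (y i) (t i)" t] by blast
  then obtain ch where ch: "\<And>i. i \<in> ?I \<Longrightarrow> ch i \<in> J"
      "\<And>i. i \<in> ?I \<Longrightarrow> t i \<le> t (ch i)"
      "\<And>i. i \<in> ?I \<Longrightarrow> cball (y i) (t i) \<inter> cball (y (ch i)) (t (ch i)) \<noteq> {}"
    by metis
  have finJ: "finite J" using finI J(1) by (rule rev_finite_subset)
  have y_near: "dist g (y (k, g)) \<le> R / 2 ^ k" if "k < m" "g \<in> G k" for k g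
    using y[OF that] \<rho> R by (force simp: subset_iff)
  have y_far: "\<rho> * (R / 2 ^ k) < dist (y (k, g)) p" if "k < m" "g \<in> G k" "p \<in> E" for k g p
    using y[OF that(1,2)] that(3) by force
  have charge: "(\<Sum>i\<in>{i \<in> ?I. ch i = j}. t i powr s) \<le> K * 4 powr s / (1 - ?q) * t j powr s"
    if "j \<in> J" for j
  proof -
    obtain l h where j: "j = (l, h)" by force
    then have lh: "l < m" "h \<in> G l" using that J(1) by auto
    define H where "H k = {g \<in> G k. g \<in> cball (y j) (3 * (R / 2 ^ k))}" for k
    have sub: "{i \<in> ?I. ch i = j} \<subseteq> Sigma {l..<m} H"
    proof
      fix i assume "i \<in> {i \<in> ?I. ch i = j}"
      then obtain k g where i: "i = (k, g)" "k < m" "g \<in> G k" "ch i = j" "i \<in> ?I" by auto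
      have "t i \<le> t j" using ch(2)[OF i(5)] i(4) by simp
      then have "l \<le> k"
        using \<rho> R i j by (simp add: t_def field_simps)
      obtain z where z: "dist (y i) z \<le> t i" "dist (y j) z \<le> t j"
        using ch(3)[OF i(5)] i(4) by auto
      \<comment> \<open>From \<open>2 * t j < dist (y j) g \<le> t j + t i + a\<close> follows
        \<open>t j < t i + a\<close>, so the distance is less than
        \<open>2 * t i + 2 * a \<le> 3 * a\<close>. It is thus controlled by the finer scale
        \<open>a\<close>, at which the points \<open>g\<close> are separated.\<close>
      define a where "a = R / 2 ^ k"
      have "dist g (y i) \<le> a" using y_near i by (simp add: a_def)
      moreover have "2 * t j < dist (y j) g"
        using y_far[OF lh] j G[OF i(2)] i(3) by (auto simp: t_def)
      moreover have "2 * t i \<le> a"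
        using \<rho> R mult_right_mono[of \<rho> 1 "R / 2 ^ k"] i(1) by (simp add: t_def a_def)
      moreover have "dist (y j) g \<le> dist (y j) z + dist (y i) z + dist g (y i)"
        using dist_triangle[of "y j" g z] dist_triangle[of z g "y i"] by (simp add: dist_commute)
      ultimately have "dist (y j) g \<le> 3 * a"
        using z by linarith
      then show "i \<in> Sigma {l..<m} H" using i \<open>l \<le> k\<close> by (simp add: H_def a_def)
    qed
    \<comment> \<open>Radius \<open>3 * a\<close> and separation \<open>2 * a\<close> with
      \<open>a = R / 2 ^ k\<close> give \<open>2 * (3 * a) + 2 * a = 4 * (2 * a)\<close>.\<close>
    have cardH: "card (H k) \<le> K * 4 powr s" if "k < m" for k
    proof (rule separated_card_le_scaled)
      show "pairwise (\<lambda>p q. 2 * (R / 2 ^ k) < dist p q) (H k)"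
        using sepG[OF that] by (rule pairwise_subset) (auto simp: H_def)
      show "ereal (2 * (R / 2 ^ k) / 2) < ediam (UNIV :: 'a set)"
        using less_ediam[OF le[of k]] by simp
      show "H k \<subseteq> cball (y j) (3 * (R / 2 ^ k))" by (auto simp: H_def)
    qed (use finG[OF that] R in \<open>auto simp: H_def\<close>)
    have "(\<Sum>i\<in>{i \<in> ?I. ch i = j}. t i powr s) \<le> (\<Sum>i\<in>Sigma {l..<m} H. t i powr s)"
      using sub finG by (intro sum_mono2) (auto simp: H_def)
    also have "\<dots> = (\<Sum>k\<in>{l..<m}. \<Sum>g\<in>H k. t (k, g) powr s)"
      using finG by (subst sum.Sigma) (auto simp: H_def)
    also have "\<dots> = (\<Sum>k\<in>{l..<m}. card (H k) * ((\<rho> * R / 2) powr s * ?q ^ k))"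
      using \<rho> R powr_div_power[of "\<rho> * R / 2" _ s] by (intro sum.cong) (auto simp: t_def field_simps)
    also have "\<dots> \<le> (\<Sum>k\<in>{l..<m}. (K * 4 powr s) * ((\<rho> * R / 2) powr s * ?q ^ k))"
      using cardH by (intro sum_mono mult_right_mono) auto
    also have "\<dots> = (K * 4 powr s) * ((\<rho> * R / 2) powr s * (\<Sum>k\<in>{l..<m}. ?q ^ k))"
      by (simp only: sum_distrib_left)
    \<comment> \<open>Only scales \<open>k \<ge> l\<close> are charged to \<open>j\<close>, so the
      series starts at the term belonging to \<open>t j\<close> itself.\<close>
    also have "\<dots> \<le> (K * 4 powr s) * ((\<rho> * R / 2) powr s * (?q ^ l / (1 - ?q)))"
      using K_ge q by (intro mult_left_mono sum_geometric_tail_le) auto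
    also have "\<dots> = K * 4 powr s / (1 - ?q) * ((\<rho> * R / 2) powr s * ?q ^ l)"
      by simp
    also have "(\<rho> * R / 2) powr s * ?q ^ l = t j powr s"
      using \<rho> R powr_div_power[of "\<rho> * R / 2" l s] by (simp add: t_def j field_simps)
    finally show ?thesis .
  qed
  \<comment> \<open>The radius \<open>2 * R\<close> suffices: a hole lies within
    \<open>R / 2 ^ l \<le> R\<close> of its net point, which is within \<open>R\<close> of
    \<open>x\<close>.\<close>
  have "(\<Sum>j\<in>J. t j powr s) \<le> K * (2 * R) powr s"
  proof (rule packing[OF finJ J(2) tpos])
    fix j assume "j \<in> J"
    then obtain l h where j: "j = (l, h)" "l < m" "h \<in> G l" using J(1) by auto
    have "\<rho> * (R / 2 ^ l) = 2 * t j" by (simp add: t_def j)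
    then have "t j \<le> \<rho> * (R / 2 ^ l)" using tpos[of j] by linarith
    moreover have "\<rho> * (R / 2 ^ l) \<le> R"
      using \<rho> R le[of l] mult_mono[of \<rho> 1 "R / 2 ^ l" R] by simp
    ultimately show "ereal (t j) < ediam (UNIV :: 'a set)" by (intro less_ediam) simp
    show "cball (y j) (t j) \<subseteq> cball x (2 * R)"
    proof
      fix z assume "z \<in> cball (y j) (t j)"
      then have "z \<in> cball (y j) (\<rho> * (R / 2 ^ l))"
        using \<open>t j \<le> \<rho> * (R / 2 ^ l)\<close> by auto
      then have "dist h z \<le> R / 2 ^ l" using y[OF j(2,3)] j(1) by auto
      moreover have "dist x h \<le> R" using G[OF j(2)] j(3) by auto
      ultimately show "z \<in> cball x (2 * R)"
        using dist_triangle[of x z h] le[of l] by simp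
    qed
  qed (use R in auto)
  then have "(\<Sum>j\<in>J. K * 4 powr s / (1 - ?q) * t j powr s) \<le>
      K * 4 powr s / (1 - ?q) * (K * (2 * R) powr s)"
    unfolding sum_distrib_left[symmetric] using K_ge q by (intro mult_left_mono) auto
  moreover have "(\<Sum>i\<in>?I. t i powr s) = (\<Sum>j\<in>J. \<Sum>i\<in>{i \<in> ?I. ch i = j}. t i powr s)"
    using finI finJ ch(1) by (intro sum.group[symmetric]) auto
  moreover have "\<dots> \<le> (\<Sum>j\<in>J. K * 4 powr s / (1 - ?q) * t j powr s)"
    by (rule sum_mono[OF charge])
  ultimately show ?thesis by linarith
qed

section \<open>Separated subsets of a porous set\<close>

text \<open>At each scale \<open>k < m\<close> the net \<open>G k\<close> must be large enough to
  cover \<open>F\<close>, so its holes carry at least a fixed share of mass. Adding the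
  \<open>m\<close> shares and comparing with \<open>hole_total_mass\<close> bounds
  \<open>card F\<close>.\<close>

lemma porous_separated_card_le:
  fixes E :: "'a set"
  assumes \<rho>: "0 < \<rho>" "\<rho> \<le> 1" and por: "porous \<rho> E"
    and "x \<in> E" and R: "0 < R" "ereal R < ediam E"
    and F: "finite F" "F \<subseteq> E \<inter> cball x R" "pairwise (\<lambda>p q. R / 2 ^ m < dist p q) F"
  shows "card F * (m * \<rho> powr s) \<le> K' * (2 powr s) ^ m"
proof -
  let ?q = "2 powr - s"
  have RX: "ereal R < ediam (UNIV :: 'a set)"
    by (rule less_le_trans[OF R(2) ediam_mono[OF subset_UNIV]])
  have le: "R / 2 ^ k \<le> R" for k
    using R by (simp add: field_simps)
  have lessX: "ereal a < ediam (UNIV :: 'a set)" if "a \<le> R" for a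
    using that RX by (metis ereal_less_eq(3) le_less_trans)
  have lessE: "ereal a < ediam E" if "a \<le> R" for a
    using that R(2) by (metis ereal_less_eq(3) le_less_trans)
  have "\<exists>G. finite G \<and> G \<subseteq> E \<inter> cball x R \<and> pairwise (\<lambda>p q. 2 * (R / 2 ^ k) < dist p q) G \<and>
      E \<inter> cball x R \<subseteq> (\<Union>g\<in>G. cball g (2 * (R / 2 ^ k)))" for k
    using lessX[OF le[of k]] R by (intro maximal_separated) auto
  then have "\<exists>G. \<forall>k. finite (G k) \<and> G k \<subseteq> E \<inter> cball x R \<and>
      pairwise (\<lambda>p q. 2 * (R / 2 ^ k) < dist p q) (G k) \<and>
      E \<inter> cball x R \<subseteq> (\<Union>g\<in>G k. cball g (2 * (R / 2 ^ k)))"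
    by (intro choice allI)
  then obtain G where G: "\<And>k. finite (G k)" "\<And>k. G k \<subseteq> E \<inter> cball x R"
      "\<And>k. pairwise (\<lambda>p q. 2 * (R / 2 ^ k) < dist p q) (G k)"
      "\<And>k. E \<inter> cball x R \<subseteq> (\<Union>g\<in>G k. cball g (2 * (R / 2 ^ k)))"
    by blast
  have "\<exists>y. cball y (\<rho> * (R / 2 ^ k)) \<subseteq> cball g (R / 2 ^ k) - E" if "g \<in> G k" for k g
  proof -
    have "g \<in> E" "0 < R / 2 ^ k" using G(2)[of k] that R by auto
    then show ?thesis using por lessE[OF le[of k]] unfolding porous_def by blast
  qed
  then have "\<forall>i. \<exists>y. snd i \<in> G (fst i) \<longrightarrow>
      cball y (\<rho> * (R / 2 ^ fst i)) \<subseteq> cball (snd i) (R / 2 ^ fst i) - E"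
    by blast
  then obtain y where y: "\<forall>i. snd i \<in> G (fst i) \<longrightarrow>
      cball (y i) (\<rho> * (R / 2 ^ fst i)) \<subseteq> cball (snd i) (R / 2 ^ fst i) - E"
    by (rule choice[THEN exE])
  have y: "cball (y (k, g)) (\<rho> * (R / 2 ^ k)) \<subseteq> cball g (R / 2 ^ k) - E" if "g \<in> G k" for k g
    using y[rule_format, of "(k, g)"] that by simp
  let ?t = "\<lambda>i. \<rho> * (R / 2 ^ fst i) / 2"
  have mass: "(\<Sum>i\<in>Sigma {..<m} G. ?t i powr s) \<le> K * 4 powr s / (1 - ?q) * (K * (2 * R) powr s)"
    by (rule hole_total_mass[where E = E and x = x and y = y, OF \<rho> R(1) RX G(1-3) y])
  have "(\<Sum>i\<in>Sigma {..<m} G. ?t i powr s) =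
      (\<Sum>k<m. card (G k) * ((\<rho> * R / 2) powr s * ?q ^ k))"
  proof -
    have "?t i = \<rho> * R / 2 / 2 ^ fst i" for i :: "nat \<times> 'a" by simp
    moreover have "0 \<le> \<rho> * R / 2" using \<rho> R by simp
    ultimately have "?t i powr s = (\<rho> * R / 2) powr s * ?q ^ fst i" for i :: "nat \<times> 'a"
      by (simp only: powr_div_power)
    then have "(\<Sum>i\<in>Sigma {..<m} G. ?t i powr s) =
        (\<Sum>i\<in>Sigma {..<m} G. (\<rho> * R / 2) powr s * ?q ^ fst i)"
      by (simp only:)
    also have "\<dots> = (\<Sum>k<m. \<Sum>g\<in>G k. (\<rho> * R / 2) powr s * ?q ^ k)"
      using G(1) by (subst sum.Sigma) (auto simp: case_prod_unfold)
    also have "\<dots> = (\<Sum>k<m. card (G k) * ((\<rho> * R / 2) powr s * ?q ^ k))"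
      by (simp only: sum_constant)
    finally show ?thesis .
  qed
  \<comment> \<open>The left side does not depend on \<open>k\<close>, so summing over the scales
    produces the factor \<open>m\<close>.\<close>
  moreover have "card F * ?q ^ m * (\<rho> * R / 2) powr s \<le>
      K * 5 powr s * (card (G k) * ((\<rho> * R / 2) powr s * ?q ^ k))" if "k < m" for k
  proof -
    \<comment> \<open>A ball of radius \<open>2 * (R / 2 ^ k)\<close> is
      \<open>2 * 2 ^ (m - k)\<close> times as wide as the separation \<open>R / 2 ^ m\<close>, and
      \<open>4 * 2 ^ (m - k) + 1 \<le> 5 * 2 ^ (m - k)\<close>.\<close>
    let ?b = "K * (5 * 2 ^ (m - k)) powr s"
    have "card F \<le> card (G k) * ?b"
    proof (rule card_le_cover_mult)
      show "F \<subseteq> (\<Union>g\<in>G k. cball g (2 * (R / 2 ^ k)))" using F(2) G(4)[of k] by blast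
      fix g assume "g \<in> G k"
      have "R / 2 ^ m / 2 \<le> R / 2 ^ m"
        using R divide_left_mono[of 1 2 "R / 2 ^ m"] by simp
      also note le
      finally have "R / 2 ^ m / 2 \<le> R" .
      have m: "(2::real) ^ m = 2 ^ (m - k) * 2 ^ k"
        using that by (simp add: power_add[symmetric])
      show "card (F \<inter> cball g (2 * (R / 2 ^ k))) \<le> ?b"
      proof (rule separated_card_le_scaled)
        show "pairwise (\<lambda>p q. R / 2 ^ m < dist p q) (F \<inter> cball g (2 * (R / 2 ^ k)))"
          using F(3) by (rule pairwise_subset) auto
        show "ereal (R / 2 ^ m / 2) < ediam (UNIV :: 'a set)"
          using \<open>R / 2 ^ m / 2 \<le> R\<close> by (rule lessX)
        have "R / 2 ^ m \<le> R / 2 ^ k" using that R by (intro divide_left_mono) auto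
        moreover have "2 ^ (m - k) * (R / 2 ^ m) = R / 2 ^ k" by (simp add: m)
        ultimately show "2 * (2 * (R / 2 ^ k)) + R / 2 ^ m \<le> 5 * 2 ^ (m - k) * (R / 2 ^ m)"
          by (simp add: mult.assoc)
      qed (use F R in auto)
    qed (use F G in auto)
    then have "card F * (?q ^ m * (\<rho> * R / 2) powr s) \<le>
        card (G k) * ?b * (?q ^ m * (\<rho> * R / 2) powr s)"
      by (intro mult_right_mono) auto
    \<comment> \<open>The growth of \<open>?b\<close> as \<open>k\<close> decreases is cancelled
      exactly by the larger holes at coarser scales.\<close>
    moreover have pow: "(5 * 2 ^ (m - k)) powr s * ?q ^ m = 5 powr s * ?q ^ k"
    proof -
      have "?q ^ m = ?q ^ (m - k) * ?q ^ k"
        using that by (simp only: power_add[symmetric]) simp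
      then have "((2::real) ^ (m - k)) powr s * ?q ^ m = (2 powr s * ?q) ^ (m - k) * ?q ^ k"
        by (simp only: power_powr zero_less_numeral power_mult_distrib mult.assoc)
      also have "2 powr s * ?q = 1" by (simp add: powr_minus)
      finally show ?thesis by (simp add: powr_mult mult.assoc)
    qed
    have "card (G k) * ?b * (?q ^ m * (\<rho> * R / 2) powr s) =
        K * 5 powr s * (card (G k) * ((\<rho> * R / 2) powr s * ?q ^ k))"
    proof -
      have "card (G k) * ?b * (?q ^ m * (\<rho> * R / 2) powr s) =
          K * card (G k) * (\<rho> * R / 2) powr s * ((5 * 2 ^ (m - k)) powr s * ?q ^ m)"
        by (simp only: mult_ac)
      also have "\<dots> = K * 5 powr s * (card (G k) * ((\<rho> * R / 2) powr s * ?q ^ k))"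
        unfolding pow by (simp only: mult_ac)
      finally show ?thesis .
    qed
    ultimately show ?thesis by (simp only: mult.assoc)
  qed
  then have "(\<Sum>k<m. card F * ?q ^ m * (\<rho> * R / 2) powr s) \<le>
      (\<Sum>k<m. K * 5 powr s * (card (G k) * ((\<rho> * R / 2) powr s * ?q ^ k)))"
    by (intro sum_mono) auto
  ultimately have "m * (card F * ?q ^ m * (\<rho> * R / 2) powr s) \<le>
      K * 5 powr s * (\<Sum>i\<in>Sigma {..<m} G. ?t i powr s)"
    by (simp only: sum_distrib_left[symmetric] sum_constant card_lessThan
        mult.left_commute[of "real m"])
  also have "\<dots> \<le> K * 5 powr s * (K * 4 powr s / (1 - ?q) * (K * (2 * R) powr s))"
    using mass K_ge by (intro mult_left_mono) auto
  also have "\<dots> = K' * (R powr s / 2 powr s)"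
    using R by (simp add: K'_def powr_mult)
  also have "m * (card F * ?q ^ m * (\<rho> * R / 2) powr s) =
      (card F * (m * \<rho> powr s) * ?q ^ m) * (R powr s / 2 powr s)"
    using \<rho> R by (simp add: powr_mult powr_divide)
  finally have "(card F * (m * \<rho> powr s) * ?q ^ m) * (R powr s / 2 powr s) \<le>
      K' * (R powr s / 2 powr s)" .
  then have "card F * (m * \<rho> powr s) * ?q ^ m \<le> K'"
    using R by (subst (asm) mult_le_cancel_right) auto
  moreover have "?q ^ m = inverse ((2 powr s) ^ m)" by (simp only: powr_minus power_inverse)
  ultimately have "card F * (m * \<rho> powr s) / (2 powr s) ^ m \<le> K'"
    by (simp only: divide_inverse)
  then show ?thesis by (subst (asm) pos_divide_le_eq) auto
qed

section \<open>From one scale ratio to Assouad exponents\<close>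

text \<open>A maximal \<open>R / 2 ^ m\<close>-separated net has at most \<open>n\<close> points,
  and the induction hypothesis applies in the ball of radius \<open>R / 2 ^ m\<close> about each.
  The net lies in \<open>E\<close>, so these balls are again admissible.\<close>

lemma iterated_separated_card_le:
  fixes E :: "'a set" and n :: real
  assumes n: "\<And>x R F. \<lbrakk>x \<in> E; 0 < R; ereal R < ediam E; finite F; F \<subseteq> E \<inter> cball x R;
      pairwise (\<lambda>p q. R / 2 ^ m < dist p q) F\<rbrakk> \<Longrightarrow> card F \<le> n"
    and "x \<in> E" "0 < R" "ereal R < ediam E" "finite F" "F \<subseteq> E \<inter> cball x R"
    and "pairwise (\<lambda>p q. R / 2 ^ (m * Suc j) < dist p q) F"
  shows "card F \<le> n ^ Suc j"
  using assms(2-)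
proof (induction j arbitrary: x R F)
  case 0
  then show ?case using n[of x R F] by simp
next
  case (Suc j)
  have le: "R / 2 ^ m \<le> R" using Suc.prems by (simp add: field_simps)
  have less: "ereal a < ediam E" if "a \<le> R" for a
    using that Suc.prems(3) by (metis ereal_less_eq(3) le_less_trans)
  have "R / 2 ^ m / 2 \<le> R / 2 ^ m"
    using Suc.prems(2) divide_left_mono[of 1 2 "R / 2 ^ m"] by simp
  also note le
  finally have "R / 2 ^ m / 2 \<le> R" .
  then have "ereal (R / 2 ^ m / 2) < ediam (UNIV :: 'a set)"
    using less_le_trans[OF less ediam_mono[OF subset_UNIV]] by blast
  then obtain G where G: "finite G" "G \<subseteq> E \<inter> cball x R"
      "pairwise (\<lambda>p q. R / 2 ^ m < dist p q) G" "E \<inter> cball x R \<subseteq> (\<Union>g\<in>G. cball g (R / 2 ^ m))"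
    using maximal_separated[of "E \<inter> cball x R" x R "R / 2 ^ m"] Suc.prems(2) by auto
  have cG: "card G \<le> n" using Suc.prems G by (intro n[of x R G])
  have "card F \<le> card G * n ^ Suc j"
  proof (rule card_le_cover_mult)
    show "F \<subseteq> (\<Union>g\<in>G. cball g (R / 2 ^ m))" using Suc.prems(5) G(4) by blast
    fix g assume "g \<in> G"
    show "card (F \<inter> cball g (R / 2 ^ m)) \<le> n ^ Suc j"
    proof (rule Suc.IH[of g])
      show "pairwise (\<lambda>p q. R / 2 ^ m / 2 ^ (m * Suc j) < dist p q) (F \<inter> cball g (R / 2 ^ m))"
        using Suc.prems(6) by (auto simp: pairwise_def power_add)
    qed (use Suc.prems G \<open>g \<in> G\<close> less[OF le] in auto)
  qed (use Suc.prems G in auto)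
  also have "\<dots> \<le> n * n ^ Suc j"
    using cG by (intro mult_right_mono) auto
  finally show ?case by simp
qed

text \<open>The ratio \<open>R / r\<close> is rounded up to a power of \<open>2 ^ m\<close>; the
  constant \<open>(2 ^ m) powr t\<close> absorbs the rounding, which costs at most one
  iteration.\<close>

lemma assouad_exponent_of_separated_card:
  fixes E :: "'a set" and t :: real
  assumes "0 < m" "0 \<le> t"
    and n: "\<And>x R F. \<lbrakk>x \<in> E; 0 < R; ereal R < ediam E; finite F; F \<subseteq> E \<inter> cball x R;
      pairwise (\<lambda>p q. R / 2 ^ m < dist p q) F\<rbrakk> \<Longrightarrow> card F \<le> (2 ^ m) powr t"
  shows "assouad_exponent E t"
  unfolding assouad_exponent_def
proof (intro exI[of _ "(2 ^ m) powr t"] conjI ballI allI impI)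
  show "1 \<le> (2 ^ m) powr t" using assms(2) by (intro ge_one_powr_ge_zero) auto
  fix x r R assume "x \<in> E" and r: "0 < r \<and> r < R \<and> ereal R < ediam E"
  then have R: "0 < R" by simp
  have "1 < (2::real) ^ m" using assms(1) by simp
  then have ex: "\<exists>i. R / r < (2 ^ m) ^ i" by (rule real_arch_pow)
  \<comment> \<open>Minimality gives \<open>(2 ^ m) ^ j \<le> R / r < (2 ^ m) ^ Suc j\<close> with
    \<open>i = Suc j\<close>; here \<open>i \<noteq> 0\<close> because
    \<open>R / r > 1\<close>.\<close>
  define i where "i = (LEAST i. R / r < (2 ^ m) ^ i)"
  have i: "R / r < (2 ^ m) ^ i" unfolding i_def using ex by (rule LeastI_ex)
  then have "i \<noteq> 0" using r by (intro notI) (simp add: field_simps)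
  then obtain j where j: "i = Suc j" by (cases i) auto
  have "\<not> R / r < (2 ^ m) ^ j" using not_less_Least[of j "\<lambda>i. R / r < (2 ^ m) ^ i"] j by (simp add: i_def)
  then have j': "(2 ^ m) ^ j \<le> R / r" by simp
  have "r / 2 \<le> R" using r by simp
  then have "ereal (r / 2) < ediam (UNIV :: 'a set)"
    using r less_le_trans[OF _ ediam_mono[OF subset_UNIV]] by (metis ereal_less_eq(3) le_less_trans)
  then obtain F where F: "finite F" "F \<subseteq> E \<inter> cball x R" "pairwise (\<lambda>p q. r < dist p q) F"
      "E \<inter> cball x R \<subseteq> (\<Union>y\<in>F. cball y r)"
    using maximal_separated[of "E \<inter> cball x R" x R r] r by auto
  have "R / 2 ^ (m * Suc j) \<le> r" using i r unfolding j power_mult by (simp add: field_simps)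
  then have sep: "pairwise (\<lambda>p q. R / 2 ^ (m * Suc j) < dist p q) F"
    using F(3) unfolding pairwise_def by (meson le_less_trans)
  have "card F \<le> ((2 ^ m) powr t) ^ Suc j"
  proof (rule iterated_separated_card_le[where E = E and m = m and x = x and R = R, rotated])
    show "card F' \<le> (2 ^ m) powr t"
      if "x' \<in> E" "0 < R'" "ereal R' < ediam E" "finite F'" "F' \<subseteq> E \<inter> cball x' R'"
        "pairwise (\<lambda>p q. R' / 2 ^ m < dist p q) F'" for x' R' F'
      using that by (rule n)
  qed (use F sep \<open>x \<in> E\<close> r R in auto)
  also have "\<dots> = (2 ^ m) powr t * ((2 ^ m) ^ j) powr t"
    by (simp add: powr_realpow[symmetric] powr_powr mult_ac)
  also have "\<dots> \<le> (2 ^ m) powr t * (R / r) powr t"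
    using j' assms(2) by (intro mult_left_mono powr_mono2) auto
  also have "(R / r) powr t = (r / R) powr (- t)"
    using r R by (simp add: powr_minus powr_divide)
  finally show "\<exists>F. finite F \<and> F \<subseteq> E \<and> card F \<le> (2 ^ m) powr t * (r / R) powr - t \<and>
      cball x R \<inter> E \<subseteq> (\<Union>y\<in>F. cball y r \<inter> E)"
    using F by (intro exI[of _ F]) auto
qed

text \<open>This settles \<open>\<rho> = 0\<close>, where no exponent is gained. The 3 comes from
  \<open>2 * R + r \<le> 3 * R\<close>.\<close>

lemma assouad_exponent_self: "assouad_exponent (E :: 'a set) s"
  unfolding assouad_exponent_def
proof (intro exI[of _ "K * 3 powr s"] conjI ballI allI impI)
  show "1 \<le> K * 3 powr s"
    using K_ge s_pos mult_mono[of 1 K 1 "3 powr s"] by (simp add: ge_one_powr_ge_zero)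
  fix x r R assume "x \<in> E" and r: "0 < r \<and> r < R \<and> ereal R < ediam E"
  then have R: "0 < R" by simp
  have "r / 2 \<le> R" using r by simp
  then have less: "ereal (r / 2) < ediam (UNIV :: 'a set)"
    using r less_le_trans[OF _ ediam_mono[OF subset_UNIV]] by (metis ereal_less_eq(3) le_less_trans)
  then obtain F where F: "finite F" "F \<subseteq> E \<inter> cball x R" "pairwise (\<lambda>p q. r < dist p q) F"
      "E \<inter> cball x R \<subseteq> (\<Union>y\<in>F. cball y r)"
    using maximal_separated[of "E \<inter> cball x R" x R r] r by auto
  have "card F \<le> K * (3 * (R / r)) powr s"
    using F r less by (intro separated_card_le_scaled[of F r x R]) auto
  also have "\<dots> = K * 3 powr s * (r / R) powr (- s)"
    using r R by (simp add: powr_minus powr_divide powr_mult)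
  finally show "\<exists>F. finite F \<and> F \<subseteq> E \<and> card F \<le> K * 3 powr s * (r / R) powr - s \<and>
      cball x R \<inter> E \<subseteq> (\<Union>y\<in>F. cball y r \<inter> E)"
    using F by (intro exI[of _ F]) auto
qed

section \<open>Choice of the number of scales and the dimension bound\<close>

lemma porous_upper_assouad_dim:
  "\<exists>c>0. \<forall>\<rho> (E :: 'a set). 0 \<le> \<rho> \<and> \<rho> \<le> 1 \<and> porous \<rho> E \<longrightarrow> upper_assouad_dim E \<le> ereal (s - c * \<rho> powr s)"
proof -
  \<comment> \<open>\<open>2 * K' \<le> L\<close> yields the factor 1/2 in the count,
    \<open>1 / s \<le> L\<close> keeps \<open>s - 1 / m\<close> nonnegative, and
    \<open>1 \<le> L\<close> ensures that rounding \<open>L / \<rho> powr s\<close> up at most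
    doubles it. That doubling explains the 2 in \<open>c = 1 / (2 * L)\<close>.\<close>
  define L where "L = max (2 * K') (max (1 / s) 1)"
  have L: "2 * K' \<le> L" "1 / s \<le> L" "1 \<le> L" by (auto simp: L_def)
  have "upper_assouad_dim E \<le> ereal (s - 1 / (2 * L) * \<rho> powr s)"
    if \<rho>: "0 \<le> \<rho>" "\<rho> \<le> 1" and por: "porous \<rho> E" for \<rho> and E :: "'a set"
  proof (cases "\<rho> = 0")
    case True
    then show ?thesis
      using upper_assouad_dim_le[OF _ assouad_exponent_self, of E] s_pos by simp
  next
    case False
    then have pos: "0 < \<rho> powr s" using \<rho> by simp
    have le1: "\<rho> powr s \<le> 1" using \<rho> s_pos powr_mono2[of s \<rho> 1] by simp
    define m where "m = nat \<lceil>L / \<rho> powr s\<rceil>"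
    have Lm: "1 \<le> L / \<rho> powr s" using pos le1 L by (simp add: field_simps)
    then have m: "L / \<rho> powr s \<le> m" "m \<le> 2 * (L / \<rho> powr s)"
      unfolding m_def by linarith+
    have m': "L \<le> m * \<rho> powr s" "m * \<rho> powr s \<le> 2 * L"
      using m pos by (simp_all add: pos_divide_le_eq pos_le_divide_eq)
    have "0 < m" using m(1) Lm by (intro Nat.gr0I) simp
    note m' = m' this
    have "m * \<rho> powr s \<le> m" using le1 by (simp add: mult_left_le)
    then have "1 / s \<le> m" using m' L by linarith
    then have t0: "0 \<le> s - 1 / m" using s_pos m' by (simp add: field_simps)
    have "assouad_exponent E (s - 1 / m)"
    proof (rule assouad_exponent_of_separated_card[OF m'(3) t0])
      fix x R F assume "x \<in> E" "0 < R" "ereal R < ediam E" "finite F" "F \<subseteq> E \<inter> cball x R"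
        "pairwise (\<lambda>p q. R / 2 ^ m < dist p q) F"
      then have *: "card F * (m * \<rho> powr s) \<le> K' * (2 powr s) ^ m"
        using \<rho> False por by (intro porous_separated_card_le) auto
      have "card F * L \<le> card F * (m * \<rho> powr s)" using m' by (intro mult_left_mono) auto
      also note *
      also have "K' * (2 powr s) ^ m \<le> L / 2 * (2 powr s) ^ m"
        using L by (intro mult_right_mono) auto
      \<comment> \<open>The factor 1/2 equals \<open>(2 ^ m) powr (- 1 / m)\<close>, which is the
        gain \<open>1 / m\<close> in the exponent.\<close>
      finally have "card F \<le> (2 powr s) ^ m / 2" using L by simp
      also have "\<dots> = 2 powr (m * s - 1)"
        by (simp add: powr_realpow[symmetric] powr_powr powr_diff mult.commute)
      also have "\<dots> = (2 ^ m) powr (s - 1 / m)"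
        using m' by (simp add: powr_realpow[symmetric] powr_powr right_diff_distrib)
      finally show "card F \<le> (2 ^ m) powr (s - 1 / m)" .
    qed
    then have "upper_assouad_dim E \<le> ereal (s - 1 / m)" by (rule upper_assouad_dim_le[OF t0])
    also have "s - 1 / m \<le> s - 1 / (2 * L) * \<rho> powr s"
    proof -
      have "\<rho> powr s \<le> 2 * L / m" using m' by (simp add: pos_le_divide_eq mult.commute)
      then have "1 / (2 * L) * \<rho> powr s \<le> 1 / (2 * L) * (2 * L / m)"
        using L by (intro mult_left_mono) auto
      then show ?thesis using L by simp
    qed
    finally show ?thesis by simp
  qed
  moreover have "0 < 1 / (2 * L)" using L by simp
  ultimately show ?thesis by blast
qed

end

section \<open>Regular spaces as packing spaces, and the conclusion\<close>

text \<open>The upper mass bound extends to radii \<open>r \<ge> diam X\<close> after enlarging \<open>C\<close>: in that case \<open>X\<close> is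
bounded, hence of finite measure, and \<open>r\<close> is at least the distance of two fixed points.\<close>

lemma regular_packing_space:
  fixes x0 y0 :: "'a::metric_space"
  assumes "x0 \<noteq> y0" "0 < s" "s_regular_space TYPE('a) s"
  obtains \<mu> :: "'a set \<Rightarrow> ennreal" and C where "packing_space \<mu> s C"
proof -
  obtain \<mu> :: "'a set \<Rightarrow> ennreal" and C where \<mu>: "measure_on_space \<mu>" and C: "1 \<le> C"
    and reg: "\<forall>x r. 0 < r \<and> ereal r < ediam (UNIV :: 'a set) \<longrightarrow>
          ennreal (inverse C * r powr s) \<le> \<mu> (cball x r) \<and> \<mu> (cball x r) \<le> ennreal (C * r powr s)"
    using assms(3) unfolding s_regular_space_def by (elim exE conjE)
  have lam: "sets borel \<subseteq> lambda_system UNIV UNIV \<mu>" and fin: "bounded A \<Longrightarrow> \<mu> A < \<infinity>" for A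
    using \<mu> by (auto simp: measure_on_space_def borel_regular_outer_measure_def)
  have incr: "\<mu> A \<le> \<mu> B" if "A \<subseteq> B" for A B
    using \<mu> that by (auto simp: measure_on_space_def borel_regular_outer_measure_def
        outer_measure_space_def increasing_def)
  let ?d = "dist x0 y0"
  define C' where "C' = max C (enn2real (\<mu> UNIV) / ?d powr s)"
  have C': "C \<le> C'" "enn2real (\<mu> UNIV) / ?d powr s \<le> C'" by (auto simp: C'_def)
  have d: "0 < ?d" using assms(1) by simp
  have "packing_space \<mu> s C'"
  proof
    show "1 \<le> C'" using C C' by simp
    fix x :: 'a and r :: real assume r: "0 < r"
    show "ennreal (inverse C' * r powr s) \<le> \<mu> (cball x r)" if "ereal r < ediam (UNIV :: 'a set)"
    proof -
      have "inverse C' * r powr s \<le> inverse C * r powr s"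
        using C C' by (intro mult_right_mono le_imp_inverse_le) auto
      then show ?thesis using reg r that by (meson ennreal_leI order_trans)
    qed
    show "\<mu> (cball x r) \<le> ennreal (C' * r powr s)"
    proof (cases "ereal r < ediam (UNIV :: 'a set)")
      case True
      have "C * r powr s \<le> C' * r powr s" using C' by (intro mult_right_mono) auto
      then show ?thesis using reg r True by (meson ennreal_leI order_trans)
    next
      case False
      then have diam: "dist p q \<le> r" for p q :: 'a
        by (intro dist_le_of_ediam_le[of UNIV]) auto
      then have "bounded (UNIV :: 'a set)" by (auto simp: bounded_def)
      then have "\<mu> UNIV = ennreal (enn2real (\<mu> UNIV))" using fin by simp
      moreover have "enn2real (\<mu> UNIV) \<le> C' * ?d powr s"
        using C'(2) d by (simp add: field_simps)
      moreover have "C' * ?d powr s \<le> C' * r powr s"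
        using C C' diam assms(2) by (intro mult_left_mono powr_mono2) auto
      ultimately have "\<mu> UNIV \<le> ennreal (C' * r powr s)"
        by (metis ennreal_leI order_trans)
      then show ?thesis using incr[of "cball x r" UNIV] by simp
    qed
  qed (use assms lam in auto)
  then show thesis by (rule that)
qed

theorem proposition3p5:
  fixes s :: real
  assumes "\<exists>x y :: 'a::metric_space. x \<noteq> y"
    and "s > 0"
    and "s_regular_space TYPE('a) s"
  shows "\<exists>c>0. \<forall>\<rho>. 0 \<le> \<rho> \<and> \<rho> \<le> 1 \<longrightarrow>
           (\<forall>E :: 'a set. E \<noteq> {} \<and> porous \<rho> E \<longrightarrow>
              upper_assouad_dim E \<le> ereal (s - c * \<rho> powr s))"
proof -
  obtain x y :: 'a where "x \<noteq> y" using assms(1) by blast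
  then obtain \<mu> :: "'a set \<Rightarrow> ennreal" and C where "packing_space \<mu> s C"
    using assms(2,3) by (rule regular_packing_space)
  from packing_space.porous_upper_assouad_dim[OF this] show ?thesis by blast
qed

end
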